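(* Consider ${\rm APP}=\{{\rm APP}_{\infty,d}\}_{d\in\mathbb N}$ in the worst case setting. For the absolute or the normalized error criterion, EXP-QPT for $\Lambda^{\rm all}$ is equivalent to EXP-QPT for $\Lambda^{\rm std}$.
   Context: $\mathbb T^d=[0,1]^d$ is the torus with Lebesgue measure; $\hat f(\mathbf k)=\int f(\mathbf x)e^{-2\pi i\mathbf k\cdot\mathbf x}d\mathbf x$. For each $d$ let $\omega_d:\mathbb Z^d\to(0,\infty)$ with $\sum_{\mathbf k}\omega_d(\mathbf k)^{-2}<\infty$, and $H^{\omega_d}(\mathbb T^d)$ the Hilbert space of $f\in L_2(\mathbb T^d)$ with $\|f\|^2=\sum_{\mathbf k}|\hat f(\mathbf k)|^2\omega_d(\mathbf k)^2<\infty$. ${\rm APP}_{\infty,d}:H^{\omega_d}(\mathbb T^d)\to L_\infty(\mathbb T^d)$ (sup norm), $f\mapsto f$. $\Lambda^{\rm all}$: all continuous linear functionals; $\Lambda^{\rm std}$: point evaluations. $e(n,{\rm APP}_{\infty,d};\Lambda)$: infimum over algorithms $A(f)=\phi(L_1f,\dots,L_nf)$, $L_i\in\Lambda$, $\phi$ arbitrary, of $\sup_{\|f\|\le1}\|f-A(f)\|_\infty$; $e(0,{\rm APP}_{\infty,d})=\sup_{\|f\|\le1}\|f\|_\infty$. $n^\star(\varepsilon,d;\Lambda)=\inf\{n\ge0:e(n,{\rm APP}_{\infty,d};\Lambda)\le\varepsilon{\rm CRI}_d\}$ with ${\rm CRI}_d=1$ (ABS) or $e(0,{\rm APP}_{\infty,d})$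 (NOR). EXP-QPT for $\Lambda$: there exist $C>0$, $t\ge0$ with $n^\star(\varepsilon,d;\Lambda)\le C\exp\big(t(1+\ln d)(1+\ln(\ln\varepsilon^{-1}+1))\big)$ for all $d\in\mathbb N,\varepsilon\in(0,1)$. *)

theory Defs
  imports "HOL-Analysis.Analysis"
begin

definition Zd :: "nat \<Rightarrow> (nat \<Rightarrow> int) set" where
  "Zd d = {k. \<forall>i\<ge>d. k i = 0}"

definition Td :: "nat \<Rightarrow> (nat \<Rightarrow> real) set" where
  "Td d = {x. (\<forall>i<d. 0 \<le> x i \<and> x i \<le> 1) \<and> (\<forall>i\<ge>d. x i = 0)}"

definition kdot :: "nat \<Rightarrow> (nat \<Rightarrow> int) \<Rightarrow> (nat \<Rightarrow> real) \<Rightarrow> real" where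
  "kdot d k x = (\<Sum>i<d. real_of_int (k i) * x i)"

definition admissible_weights :: "(nat \<Rightarrow> (nat \<Rightarrow> int) \<Rightarrow> real) \<Rightarrow> bool" where
  "admissible_weights \<omega> \<longleftrightarrow>
     (\<forall>d. (\<forall>k\<in>Zd d. \<omega> d k > 0) \<and> (\<lambda>k. (\<omega> d k) powi (-2)) summable_on Zd d)"

text \<open>Elements of H^omega_d, represented by their Fourier coefficient families.\<close>
definition Hspace :: "(nat \<Rightarrow> (nat \<Rightarrow> int) \<Rightarrow> real) \<Rightarrow> nat \<Rightarrow> ((nat \<Rightarrow> int) \<Rightarrow> complex) set" where
  "Hspace \<omega> d = {c. (\<forall>k. k \<notin> Zd d \<longrightarrow> c k = 0) \<and>
        (\<lambda>k. (cmod (c k))\<^sup>2 * (\<omega> d k)\<^sup>2) summable_on Zd d}"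

definition Hnorm :: "(nat \<Rightarrow> (nat \<Rightarrow> int) \<Rightarrow> real) \<Rightarrow> nat \<Rightarrow> ((nat \<Rightarrow> int) \<Rightarrow> complex) \<Rightarrow> real" where
  "Hnorm \<omega> d c = sqrt (\<Sum>\<^sub>\<infinity>k\<in>Zd d. (cmod (c k))\<^sup>2 * (\<omega> d k)\<^sup>2)"

definition fval :: "nat \<Rightarrow> ((nat \<Rightarrow> int) \<Rightarrow> complex) \<Rightarrow> (nat \<Rightarrow> real) \<Rightarrow> complex" where
  "fval d c x = (\<Sum>\<^sub>\<infinity>k\<in>Zd d. c k * exp (2 * of_real pi * \<i> * of_real (kdot d k x)))"

definition Lam_all :: "(nat \<Rightarrow> (nat \<Rightarrow> int) \<Rightarrow> real) \<Rightarrow> nat \<Rightarrow> (((nat \<Rightarrow> int) \<Rightarrow> complex) \<Rightarrow> complex) set" where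
  "Lam_all \<omega> d = {L.
     (\<forall>c\<in>Hspace \<omega> d. \<forall>c'\<in>Hspace \<omega> d. L (\<lambda>k. c k + c' k) = L c + L c') \<and>
     (\<forall>c\<in>Hspace \<omega> d. \<forall>a::complex. L (\<lambda>k. a * c k) = a * L c) \<and>
     (\<exists>M. \<forall>c\<in>Hspace \<omega> d. cmod (L c) \<le> M * Hnorm \<omega> d c)}"

definition Lam_std :: "(nat \<Rightarrow> (nat \<Rightarrow> int) \<Rightarrow> real) \<Rightarrow> nat \<Rightarrow> (((nat \<Rightarrow> int) \<Rightarrow> complex) \<Rightarrow> complex) set" where
  "Lam_std \<omega> d = {L. \<exists>x\<in>Td d. \<forall>c. L c = fval d c x}"

definition sup_dist :: "nat \<Rightarrow> ((nat \<Rightarrow> real) \<Rightarrow> complex) \<Rightarrow> ((nat \<Rightarrow> real) \<Rightarrow> complex) \<Rightarrow> ereal" where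
  "sup_dist d f g = (SUP x\<in>Td d. ereal (cmod (f x - g x)))"

definition err_n :: "(nat \<Rightarrow> (nat \<Rightarrow> int) \<Rightarrow> real)
     \<Rightarrow> ((nat \<Rightarrow> (nat \<Rightarrow> int) \<Rightarrow> real) \<Rightarrow> nat \<Rightarrow> (((nat \<Rightarrow> int) \<Rightarrow> complex) \<Rightarrow> complex) set)
     \<Rightarrow> nat \<Rightarrow> nat \<Rightarrow> ereal" where
  "err_n \<omega> Lam d n =
     (INF LP\<in>{(Ls, \<phi> :: complex list \<Rightarrow> (nat \<Rightarrow> real) \<Rightarrow> complex).
                         length Ls = n \<and> set Ls \<subseteq> Lam \<omega> d}.
        SUP c\<in>{c\<in>Hspace \<omega> d. Hnorm \<omega> d c \<le> 1}.
          sup_dist d (fval d c) ((snd LP) (map (\<lambda>L. L c) (fst LP))))"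

definition err0 :: "(nat \<Rightarrow> (nat \<Rightarrow> int) \<Rightarrow> real) \<Rightarrow> nat \<Rightarrow> ereal" where
  "err0 \<omega> d = (SUP c\<in>{c\<in>Hspace \<omega> d. Hnorm \<omega> d c \<le> 1}. sup_dist d (fval d c) (\<lambda>_. 0))"

datatype criterion = ABS | NOR

definition CRI :: "criterion \<Rightarrow> (nat \<Rightarrow> (nat \<Rightarrow> int) \<Rightarrow> real) \<Rightarrow> nat \<Rightarrow> ereal" where
  "CRI cr \<omega> d = (case cr of ABS \<Rightarrow> 1 | NOR \<Rightarrow> err0 \<omega> d)"

text \<open>n^star(eps,d) \<le> B, where n^star = inf of an empty set means infinity
  (so the bound then fails).\<close>
definition EXP_QPT :: "(nat \<Rightarrow> (nat \<Rightarrow> int) \<Rightarrow> real)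
     \<Rightarrow> ((nat \<Rightarrow> (nat \<Rightarrow> int) \<Rightarrow> real) \<Rightarrow> nat \<Rightarrow> (((nat \<Rightarrow> int) \<Rightarrow> complex) \<Rightarrow> complex) set)
     \<Rightarrow> criterion \<Rightarrow> bool" where
  "EXP_QPT \<omega> Lam cr \<longleftrightarrow>
     (\<exists>C>0. \<exists>t\<ge>0. \<forall>d\<ge>1. \<forall>\<epsilon>::real. 0 < \<epsilon> \<and> \<epsilon> < 1 \<longrightarrow>
        (\<exists>n. err_n \<omega> Lam d n \<le> ereal \<epsilon> * CRI cr \<omega> d) \<and>
        real (LEAST n. err_n \<omega> Lam d n \<le> ereal \<epsilon> * CRI cr \<omega> d)
          \<le> C * exp (t * (1 + ln (real d)) * (1 + ln (ln (1 / \<epsilon>) + 1))))"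

end

theory Submission
  imports Defs
begin

text \<open>
  The two classes of information are compared through
  \<open>e(4n; \<Lambda>\<^sup>s\<^sup>t\<^sup>d) \<le> 8 e(n; \<Lambda>\<^sup>a\<^sup>l\<^sup>l)\<close>; the constants are absorbed by the exponent \<open>t\<close>, because
  \<open>ln (8/\<epsilon>) + 1 \<le> (1 + ln 8) (ln (1/\<epsilon>) + 1)\<close>.

  An algorithm of error \<open>e\<close> using \<open>n\<close> functionals forces \<open>|f(x)| \<le> e\<close> on the unit ball of their
  common kernel. Choose \<open>N\<close> points whose evaluation functionals span a parallelepiped of nearly maximal
  volume. If some \<open>f\<close> in the unit ball vanishes there but has \<open>|f(x)| = \<sigma>\<close>, then by maximality
  each of the \<open>N + 1\<close> functionals, that of \<open>x\<close> included, has distance at least \<open>\<sigma>/2\<close> to the span of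
  the others, so the dual basis \<open>h\<^sub>i\<close> has norms at most \<open>2/\<sigma>\<close>. The orthogonal projection \<open>P\<close> onto the
  kernel has trace at least \<open>N + 1 - m\<close> on the span, \<open>m\<close> being the number of functionals, while this
  trace is \<open>\<Sum>\<^sub>i (P h\<^sub>i)(x\<^sub>i) \<le> (N + 1) e 2/\<sigma>\<close>. With \<open>N = 2m\<close> this gives \<open>\<sigma> \<le> 4e\<close>. The space is treated as a
  real Hilbert space, so that \<open>m = 2n\<close>; returning any element of the ball that matches the sampled
  data costs another factor 2.
\<close>

section \<open>Orthogonal components relative to finite sets\<close>

text \<open>Since \<open>b - b'\<close> lies in \<open>span A\<close>, a vector orthogonal to
  \<open>span A\<close> and to \<open>b'\<close> is orthogonal to \<open>b\<close> too;
  \<open>r\<close> is \<open>a'\<close> minus its projection on \<open>b'\<close>. If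
  \<open>b' = 0\<close>, the quotient is 0 by convention and \<open>r = a'\<close>.\<close>

lemma gram_schmidt_step:
  fixes a b a' b' :: "'a::real_inner"
  assumes a: "a - a' \<in> span A" "\<And>s. s \<in> span A \<Longrightarrow> a' \<bullet> s = 0"
    and b: "b - b' \<in> span A" "\<And>s. s \<in> span A \<Longrightarrow> b' \<bullet> s = 0"
  defines "r \<equiv> a' - (a' \<bullet> b' / (b' \<bullet> b')) *\<^sub>R b'"
  shows "a - r \<in> span (insert b A)" and "\<And>s. s \<in> span (insert b A) \<Longrightarrow> r \<bullet> s = 0"
proof -
  have sub: "span A \<subseteq> span (insert b A)" by (intro span_mono) auto
  have "b' \<in> span (insert b A)"
    using span_diff[OF span_base[of b "insert b A"] subsetD[OF sub b(1)]] by simp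
  then show "a - r \<in> span (insert b A)"
    using span_add[OF subsetD[OF sub a(1)] span_scale[of b' "insert b A" "a' \<bullet> b' / (b' \<bullet> b')"]]
    by (simp add: r_def algebra_simps)
  have rA: "r \<bullet> t = 0" if "t \<in> span A" for t
    using a(2) b(2) that by (simp add: r_def inner_diff_left)
  have "r \<bullet> b' = 0" by (cases "b' = 0") (auto simp: r_def inner_diff_left)
  moreover have "r \<bullet> b = r \<bullet> (b - b') + r \<bullet> b'" by (simp add: inner_diff_right)
  ultimately have rb: "r \<bullet> b = 0" using rA[OF b(1)] by simp
  fix s assume "s \<in> span (insert b A)"
  then obtain k where k: "s - k *\<^sub>R b \<in> span A" unfolding span_insert by blast
  have "r \<bullet> s = r \<bullet> (s - k *\<^sub>R b) + k * (r \<bullet> b)" by (simp add: inner_diff_right)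
  then show "r \<bullet> s = 0" using rA[OF k] rb by simp
qed

lemma residual_exists:
  fixes a :: "'a::real_inner"
  assumes "finite A"
  shows "\<exists>r. a - r \<in> span A \<and> (\<forall>s\<in>span A. r \<bullet> s = 0)"
  using assms
proof (induction A arbitrary: a rule: finite_induct)
  case empty
  then show ?case by (intro exI[of _ a]) auto
next
  case (insert b A)
  obtain a' where "a - a' \<in> span A" "\<And>s. s \<in> span A \<Longrightarrow> a' \<bullet> s = 0" using insert.IH by blast
  moreover obtain b' where "b - b' \<in> span A" "\<And>s. s \<in> span A \<Longrightarrow> b' \<bullet> s = 0"
    using insert.IH by blast
  ultimately show ?case using gram_schmidt_step[of a a' A b b'] by blast
qed

text \<open>The component of \<open>a\<close> orthogonal to \<open>span A\<close>; only meaningful for finite \<open>A\<close>,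
  where orthogonal projections exist without completeness.\<close>
definition residual :: "'a::real_inner set \<Rightarrow> 'a \<Rightarrow> 'a" where
  "residual A a = (SOME r. a - r \<in> span A \<and> (\<forall>s\<in>span A. r \<bullet> s = 0))"

lemma
  fixes a :: "'a::real_inner"
  assumes "finite A"
  shows residual_diff_in_span: "a - residual A a \<in> span A"
    and residual_orthogonal: "s \<in> span A \<Longrightarrow> residual A a \<bullet> s = 0"
  using someI_ex[OF residual_exists[OF assms, of a]] unfolding residual_def by auto

lemma residual_unique:
  fixes a :: "'a::real_inner"
  assumes "finite A" "a - r \<in> span A" "\<And>s. s \<in> span A \<Longrightarrow> r \<bullet> s = 0"
  shows "residual A a = r"
proof -
  let ?d = "residual A a - r"
  have "?d = (a - r) - (a - residual A a)" by simp
  then have d: "?d \<in> span A"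
    using span_diff[OF assms(2) residual_diff_in_span[OF assms(1), of a]] by simp
  have "?d \<bullet> ?d = 0"
    using residual_orthogonal[OF assms(1) d, of a] assms(3)[OF d] by (simp add: inner_diff_left)
  then show ?thesis by simp
qed

lemma residual_empty [simp]: "residual {} a = a"
  by (rule residual_unique) auto

lemma residual_in_span:
  assumes "finite A" "A \<subseteq> span B" "a \<in> span B"
  shows "residual A a \<in> span B"
proof -
  have "span A \<subseteq> span B" using assms(2) by (simp add: span_minimal)
  then have "a - (a - residual A a) \<in> span B"
    using residual_diff_in_span[OF assms(1), of a] assms(3) by (blast intro: span_diff)
  then show ?thesis by simp
qed

lemma residual_insert:
  assumes "finite A"
  shows "residual (insert b A) a = residual A a
    - (residual A a \<bullet> residual A b / (residual A b \<bullet> residual A b)) *\<^sub>R residual A b"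
  using gram_schmidt_step[OF residual_diff_in_span[OF assms] residual_orthogonal[OF assms]
      residual_diff_in_span[OF assms] residual_orthogonal[OF assms]] assms
  by (intro residual_unique) auto

lemma inner_residual_self:
  assumes "finite A"
  shows "residual A a \<bullet> a = residual A a \<bullet> residual A a"
  using residual_orthogonal[OF assms residual_diff_in_span[OF assms], of a a]
  by (simp add: inner_diff_right)

lemma norm_residual_le:
  assumes "finite A"
  shows "norm (residual A a) \<le> norm a"
proof (cases "residual A a = 0")
  case False
  have "norm (residual A a) * norm (residual A a) \<le> norm (residual A a) * norm a"
    using norm_cauchy_schwarz[of "residual A a" a] inner_residual_self[OF assms, of a]
    by (simp add: power2_norm_eq_inner flip: power2_eq_square)
  then show ?thesis using False by simp
qed simp

text \<open>Squared, both sides are the Gram determinant of \<open>residual A a\<close> and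
  \<open>residual A b\<close>, which is symmetric in the two vectors.\<close>

lemma residual_swap:
  assumes "finite A"
  shows "norm (residual (insert b A) a) * norm (residual A b)
       = norm (residual (insert a A) b) * norm (residual A a)"
proof -
  let ?f = "\<lambda>a b. (norm (residual A a))\<^sup>2 * (norm (residual A b))\<^sup>2
    - (residual A a \<bullet> residual A b)\<^sup>2"
  have *: "(norm (residual (insert b A) a) * norm (residual A b))\<^sup>2 = ?f a b" for a b
  proof (cases "residual A b = 0")
    case False
    then show ?thesis
      unfolding residual_insert[OF assms] power_mult_distrib power2_norm_eq_inner
      by (simp add: inner_diff_left inner_diff_right inner_commute field_simps power2_eq_square)
  qed simp
  have "?f a b = ?f b a" by (simp add: inner_commute mult.commute)
  then show ?thesis
    using *[of b a] *[of a b] by (metis mult_nonneg_nonneg norm_ge_zero power2_eq_imp_eq)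
qed

section \<open>Volumes of parallelepipeds\<close>

text \<open>The volume of the parallelepiped spanned by the list, computed as base times height; it
  vanishes for linearly dependent lists.\<close>

fun parvol :: "'a::real_inner list \<Rightarrow> real" where
  "parvol [] = 1"
| "parvol (a # as) = norm (residual (set as) a) * parvol as"

lemma parvol_nonneg: "0 \<le> parvol xs"
  by (induction xs) auto

lemma parvol_move: "parvol (xs @ a # ys) = parvol (a # xs @ ys)"
proof (induction xs)
  case (Cons x xs)
  have "parvol ((x # xs) @ a # ys) = norm (residual (insert a (set (xs @ ys))) x) * parvol (a # xs @ ys)"
    using Cons by (simp add: insert_commute Un_commute)
  also have "\<dots> = parvol (a # (x # xs) @ ys)"
    using residual_swap[of "set (xs @ ys)" a x] by simp
  finally show ?case .
qed simp

text \<open>Hadamard's inequality: no height exceeds the length of its edge. It makes the supremum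
  over all lists of a fixed length finite.\<close>

lemma parvol_le:
  assumes "\<And>x. x \<in> set xs \<Longrightarrow> norm x \<le> M" "0 \<le> M"
  shows "parvol xs \<le> M ^ length xs"
  using assms(1)
proof (induction xs)
  case (Cons x xs)
  have "norm (residual (set xs) x) \<le> M" using norm_residual_le[of "set xs" x] Cons.prems[of x] by auto
  then show ?case using Cons assms(2) by (auto intro!: mult_mono parvol_nonneg)
qed simp

text \<open>A list of nearly maximal volume: exchanging one of its members for \<open>s\<close> at most doubles
  the volume, which bounds the distance of that member to the others from below.\<close>
lemma near_maximal_volume:
  fixes S :: "'a::real_inner set"
  assumes bd: "\<And>s. s \<in> S \<Longrightarrow> norm s \<le> M" and "S \<noteq> {}"
  obtains xs where "length xs = N" "set xs \<subseteq> S"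
    "\<And>s. s \<in> S \<Longrightarrow> residual (set xs) s \<noteq> 0 \<Longrightarrow>
      distinct (s # xs) \<and> (\<forall>a \<in> set (s # xs).
        norm (residual (set (s # xs) - {a}) a) \<ge> norm (residual (set xs) s) / 2)"
proof -
  obtain s0 where s0: "s0 \<in> S" using assms by blast
  have M0: "0 \<le> M" using bd[OF s0] norm_ge_zero order_trans by blast
  define X where "X n = {xs. length xs = n \<and> set xs \<subseteq> S}" for n
  have X0: "parvol xs \<le> M ^ n" if "xs \<in> X n" for xs n
    using parvol_le[of xs M] that bd M0 by (auto simp: X_def)
  show ?thesis
  proof (cases "\<exists>xs\<in>X N. parvol xs > 0")
    case True
    then obtain ws where ws: "ws \<in> X N" "parvol ws > 0" by blast
    define V where "V = (SUP xs\<in>X N. parvol xs)"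
    have bdd: "bdd_above (parvol ` X N)" using X0 by (auto intro!: bdd_aboveI)
    have V: "parvol xs \<le> V" if "xs \<in> X N" for xs
      unfolding V_def using bdd that by (rule cSUP_upper2[OF _ _ order_refl])
    have V0: "V > 0" using V[OF ws(1)] ws(2) by simp
    \<comment> \<open>The supremum need not be attained, so half of it is the target; this is the
      source of the factor 1/2 in the conclusion.\<close>
    have "\<exists>xs\<in>X N. V / 2 < parvol xs"
      using less_cSUP_iff[OF _ bdd, of "V / 2"] ws(1) V0 unfolding V_def[symmetric] by auto
    then obtain xs where xs: "xs \<in> X N" "V / 2 < parvol xs" by blast
    show ?thesis
    proof (rule that[of xs])
      fix s assume s: "s \<in> S" "residual (set xs) s \<noteq> 0"
      define \<sigma> where "\<sigma> = norm (residual (set xs) s)"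
      have \<sigma>: "\<sigma> > 0" using s by (simp add: \<sigma>_def)
      have big: "\<sigma> * (V / 2) < parvol (s # xs)" using xs \<sigma> by (simp add: \<sigma>_def[symmetric])
      have split: "norm (residual (set (ys @ zs)) a) \<ge> \<sigma> / 2" if "s # xs = ys @ a # zs" for a ys zs
      proof -
        have "ys @ zs \<in> X N"
        proof -
          have "length (s # xs) = length (ys @ a # zs)" "set (ys @ a # zs) = set (s # xs)"
            using that by simp_all
          then show ?thesis using xs(1) s(1) by (auto simp: X_def)
        qed
        \<comment> \<open>Moving \<open>a\<close> to the front factors the volume of
          \<open>s # xs\<close> as the height of \<open>a\<close> times the volume of
          \<open>ys @ zs\<close>, which is at most \<open>V\<close>.\<close>
        then have "\<sigma> * (V / 2) < norm (residual (set (ys @ zs)) a) * V"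
          using big that parvol_move[of ys a zs] mult_left_mono[OF V[of "ys @ zs"], of "norm (residual (set (ys @ zs)) a)"]
          by auto
        then show ?thesis using V0 by (simp add: field_simps)
      qed
      have notin: "a \<notin> set (ys @ zs)" if "s # xs = ys @ a # zs" for a ys zs
      proof
        assume a: "a \<in> set (ys @ zs)"
        have "residual (set (ys @ zs)) a = 0"
          by (rule residual_unique) (use a in \<open>auto intro: span_base\<close>)
        then show False using split[OF that] \<sigma> by simp
      qed
      have "distinct (s # xs)"
        using notin not_distinct_decomp[of "s # xs"] by fastforce
      moreover have "norm (residual (set (s # xs) - {a}) a) \<ge> \<sigma> / 2" if "a \<in> set (s # xs)" for a
      proof -
        obtain ys zs where yz: "s # xs = ys @ a # zs" using split_list[of a "s # xs"] \<open>a \<in> set (s # xs)\<close> by blast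
        then have "set (s # xs) - {a} = set (ys @ zs)" using notin[OF yz] by auto
        then show ?thesis using split[OF yz] by simp
      qed
      ultimately show "distinct (s # xs) \<and> (\<forall>a \<in> set (s # xs).
        norm (residual (set (s # xs) - {a}) a) \<ge> norm (residual (set xs) s) / 2)"
        by (simp add: \<sigma>_def)
    qed (use xs in \<open>auto simp: X_def\<close>)
  next
    case False
    \<comment> \<open>Degenerate case: if \<open>n = Suc m\<close> is the least length at which all
      volumes vanish, a list of length \<open>m\<close> with nonzero volume already has
      \<open>S\<close> in its span. Padding it with \<open>s0\<close> gives length \<open>N\<close>,
      and the claim about \<open>s\<close> becomes vacuous.\<close>
    define P where "P n \<longleftrightarrow> (\<forall>xs\<in>X n. parvol xs = 0)" for n
    have PN: "P N" using False parvol_nonneg by (auto simp: P_def not_less intro: antisym)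
    define n where "n = (LEAST n. P n)"
    have Pn: "P n" and nN: "n \<le> N" using PN by (auto simp: n_def intro: LeastI Least_le)
    have "\<not> P 0" by (auto simp: P_def X_def)
    then obtain m where m: "n = Suc m" using Pn by (cases n) auto
    have "\<not> P m" using not_less_Least[of m P] m by (simp add: n_def)
    then obtain xs where xs: "xs \<in> X m" "parvol xs \<noteq> 0" by (auto simp: P_def)
    let ?ys = "xs @ replicate (N - m) s0"
    show ?thesis
    proof (rule that[of ?ys])
      fix s assume s: "s \<in> S" "residual (set ?ys) s \<noteq> 0"
      have "s # xs \<in> X n" using xs s(1) by (auto simp: X_def m)
      then have "parvol (s # xs) = 0" using Pn unfolding P_def by blast
      then have "residual (set xs) s = 0" using xs by simp
      then have "s \<in> span (set xs)" using residual_diff_in_span[of "set xs" s] by simp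
      moreover have "span (set xs) \<subseteq> span (set ?ys)" by (intro span_mono) auto
      ultimately have "residual (set ?ys) s = 0" by (intro residual_unique) auto
      then show "distinct (s # ?ys) \<and> (\<forall>a \<in> set (s # ?ys).
        norm (residual (set (s # ?ys) - {a}) a) \<ge> norm (residual (set ?ys) s) / 2)"
        using s(2) by simp
    qed (use xs s0 nN m in \<open>auto simp: X_def\<close>)
  qed
qed

section \<open>Trace bound and comparison in an inner product space\<close>

text \<open>For a biorthogonal system \<open>h\<close> of \<open>A\<close> the sum is the trace of \<open>residual B\<close> on \<open>span A\<close>,
  a projection whose kernel has dimension at most \<open>card B\<close>.\<close>
lemma trace_residual:
  fixes A :: "'a::real_inner set"
  assumes exp: "\<And>v. v \<in> span A \<Longrightarrow> v = (\<Sum>s\<in>A. (v \<bullet> s) *\<^sub>R h s)"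
    and dual: "\<And>s. s \<in> A \<Longrightarrow> h s \<bullet> s = 1"
    and "finite B" "B \<subseteq> span A"
  shows "real (card A) - real (card B) \<le> (\<Sum>s\<in>A. residual B (h s) \<bullet> s)"
  using assms(3,4)
proof (induction B rule: finite_induct)
  case empty
  then show ?case using dual by simp
next
  case (insert b B)
  let ?b = "residual B b"
  have b: "?b \<in> span A" by (rule residual_in_span) (use insert in auto)
  have o: "residual B v \<bullet> ?b = v \<bullet> ?b" for v
    using residual_orthogonal[OF \<open>finite B\<close> residual_diff_in_span[OF \<open>finite B\<close>, of v], of b]
    by (simp add: inner_diff_right inner_commute)
  \<comment> \<open>Inserting \<open>b\<close> subtracts from the trace that of the rank-one
    projection onto \<open>?b\<close>. Expanding \<open>?b\<close> in the biorthogonal system shows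
    that this is 1, or 0 if \<open>?b = 0\<close>.\<close>
  have "?b \<bullet> ?b = (\<Sum>s\<in>A. (?b \<bullet> s) *\<^sub>R h s) \<bullet> ?b" using exp[OF b] by simp
  also have "\<dots> = (\<Sum>s\<in>A. (h s \<bullet> ?b) * (?b \<bullet> s))"
    by (simp add: inner_sum_left mult.commute)
  finally have bb: "(\<Sum>s\<in>A. (h s \<bullet> ?b) * (?b \<bullet> s)) = ?b \<bullet> ?b" ..
  have "(\<Sum>s\<in>A. residual (insert b B) (h s) \<bullet> s)
      = (\<Sum>s\<in>A. residual B (h s) \<bullet> s) - (\<Sum>s\<in>A. (h s \<bullet> ?b) * (?b \<bullet> s)) / (?b \<bullet> ?b)"
    by (simp add: residual_insert[OF \<open>finite B\<close>] o inner_diff_left sum_subtractf sum_divide_distrib)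
  also have "\<dots> \<ge> (\<Sum>s\<in>A. residual B (h s) \<bullet> s) - 1" unfolding bb by (cases "?b = 0") auto
  finally show ?case using insert by auto
qed

lemma vanishing_on_near_maximal_volume:
  fixes S :: "'a::real_inner set"
  assumes bd: "\<And>s. s \<in> S \<Longrightarrow> norm s \<le> M" and "S \<noteq> {}"
    and \<Lambda>: "finite \<Lambda>" "card \<Lambda> \<le> m" "\<And>L. L \<in> \<Lambda> \<Longrightarrow> linear L"
    and ker: "\<And>f s. norm f \<le> 1 \<Longrightarrow> (\<And>L. L \<in> \<Lambda> \<Longrightarrow> L f = (0::real)) \<Longrightarrow> s \<in> S \<Longrightarrow> \<bar>f \<bullet> s\<bar> \<le> e"
  obtains xs where "length xs = 2 * m" "set xs \<subseteq> S"
    "\<And>f s. norm f \<le> 1 \<Longrightarrow> (\<And>x. x \<in> set xs \<Longrightarrow> f \<bullet> x = 0) \<Longrightarrow> s \<in> S \<Longrightarrow> \<bar>f \<bullet> s\<bar> \<le> 4 * e"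
proof -
  have e0: "0 \<le> e"
  proof -
    obtain s where "s \<in> S" using assms by blast
    then show ?thesis using ker[of 0 s] \<Lambda>(3) linear_0 by force
  qed
  \<comment> \<open>The homogeneous form is needed because the vectors it is applied to below have
    norm bounded only by \<open>2 / \<sigma>\<close>.\<close>
  have ker': "\<bar>f \<bullet> s\<bar> \<le> e * norm f" if "\<And>L. L \<in> \<Lambda> \<Longrightarrow> L f = 0" "s \<in> S" for f s
  proof (cases "f = 0")
    case False
    have "\<bar>(f /\<^sub>R norm f) \<bullet> s\<bar> \<le> e"
      using that \<Lambda>(3) False by (intro ker) (auto simp: linear_cmul)
    then show ?thesis using False by (simp add: abs_mult field_simps)
  qed simp
  obtain xs where xs: "length xs = 2 * m" "set xs \<subseteq> S"
    and vol: "\<And>s. s \<in> S \<Longrightarrow> residual (set xs) s \<noteq> 0 \<Longrightarrow>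
      distinct (s # xs) \<and> (\<forall>a \<in> set (s # xs).
        norm (residual (set (s # xs) - {a}) a) \<ge> norm (residual (set xs) s) / 2)"
    using near_maximal_volume[OF bd \<open>S \<noteq> {}\<close>, of "2 * m"] by blast
  have main: "norm (residual (set xs) s) \<le> 4 * e" if s: "s \<in> S" for s
  proof (cases "residual (set xs) s = 0")
    case True
    then show ?thesis using e0 by simp
  next
    case False
    define \<sigma> where "\<sigma> = norm (residual (set xs) s)"
    have \<sigma>: "\<sigma> > 0" using False by (simp add: \<sigma>_def)
    define A where "A = set (s # xs)"
    have A: "finite A" "card A = 2 * m + 1" "A \<subseteq> S"
      using vol[OF s False] xs s distinct_card[of "s # xs"] by (auto simp: A_def)
    define \<rho> where "\<rho> a = residual (A - {a}) a" for a
    have \<rho>: "norm (\<rho> a) \<ge> \<sigma> / 2" if "a \<in> A" for a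
      using vol[OF s False] that by (auto simp: \<rho>_def A_def \<sigma>_def)
    have \<rho>0: "\<rho> a \<noteq> 0" if "a \<in> A" for a using \<rho>[OF that] \<sigma> by auto
    \<comment> \<open>The dual basis: the residual is orthogonal to the other members of
      \<open>A\<close>, and the scaling gives inner product 1 with \<open>a\<close>. A large height
      makes \<open>h a\<close> short.\<close>
    define h where "h a = (1 / (\<rho> a \<bullet> \<rho> a)) *\<^sub>R \<rho> a" for a
    have h1: "h a \<bullet> a = 1" if "a \<in> A" for a
      using inner_residual_self[of "A - {a}" a] A(1) \<rho>0[OF that] by (simp add: h_def \<rho>_def)
    have h0: "h a \<bullet> b = 0" if "b \<in> A" "b \<noteq> a" for a b
      using residual_orthogonal[of "A - {a}" b a] A(1) that by (simp add: h_def \<rho>_def span_base)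
    have hspan: "h a \<in> span A" if "a \<in> A" for a
      unfolding h_def \<rho>_def
      by (intro span_scale residual_in_span) (use that A(1) in \<open>auto intro: span_base\<close>)
    have hnorm: "norm (h a) \<le> 2 / \<sigma>" if "a \<in> A" for a
    proof -
      have "norm (h a) = 1 / norm (\<rho> a)"
        using \<rho>0[OF that] by (simp add: h_def dot_square_norm power2_eq_square)
      also have "\<dots> \<le> 1 / (\<sigma> / 2)" by (rule divide_left_mono) (use \<rho>[OF that] \<rho>0[OF that] \<sigma> in auto)
      finally show ?thesis by simp
    qed
    have exp: "v = (\<Sum>a\<in>A. (v \<bullet> a) *\<^sub>R h a)" if v: "v \<in> span A" for v
    proof -
      let ?w = "v - (\<Sum>a\<in>A. (v \<bullet> a) *\<^sub>R h a)"
      have w: "?w \<in> span A" by (intro span_diff v span_sum span_scale hspan)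
      have "?w \<bullet> b = 0" if "b \<in> A" for b
      proof -
        have "(\<Sum>a\<in>A. (v \<bullet> a) *\<^sub>R h a) \<bullet> b = (\<Sum>a\<in>A. if a = b then v \<bullet> a else 0)"
          unfolding inner_sum_left by (intro sum.cong) (use that h0 h1 in auto)
        then show ?thesis using that A(1) by (simp add: inner_diff_left)
      qed
      then have "orthogonal ?w ?w"
        by (intro orthogonal_to_span[OF w]) (auto simp: orthogonal_def)
      then show ?thesis by (simp add: orthogonal_self)
    qed
    \<comment> \<open>The dual basis yields representers on \<open>span A\<close> by a finite sum,
      so that within \<open>span A\<close> the common kernel is the orthogonal complement of
      \<open>B\<close>.\<close>
    define riesz where "riesz L = (\<Sum>a\<in>A. L (h a) *\<^sub>R a)" for L :: "'a \<Rightarrow> real"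
    define B where "B = riesz ` \<Lambda>"
    have B: "finite B" "card B \<le> m"
      using \<Lambda>(1,2) card_image_le[OF \<Lambda>(1), of riesz] by (auto simp: B_def)
    have "riesz L \<in> span A" for L
      unfolding riesz_def by (intro span_sum span_scale span_base)
    then have B3: "B \<subseteq> span A" by (auto simp: B_def)
    have riesz: "L v = v \<bullet> riesz L" if "v \<in> span A" "L \<in> \<Lambda>" for v L
    proof -
      have "L v = L (\<Sum>a\<in>A. (v \<bullet> a) *\<^sub>R h a)" using exp[OF that(1)] by simp
      also have "\<dots> = v \<bullet> riesz L"
        using \<Lambda>(3)[OF that(2)]
        by (simp add: linear_sum linear_cmul riesz_def inner_sum_right mult.commute)
      finally show ?thesis .
    qed
    \<comment> \<open>Being orthogonal to \<open>B\<close>, the vector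
      \<open>residual B (h a)\<close> lies in the common kernel, so its inner product with
      \<open>a\<close> is controlled by \<open>e\<close>.\<close>
    have "residual B (h a) \<bullet> a \<le> e * (2 / \<sigma>)" if a: "a \<in> A" for a
    proof -
      have r: "residual B (h a) \<in> span A" by (rule residual_in_span) (use B B3 hspan a in auto)
      have "\<bar>residual B (h a) \<bullet> a\<bar> \<le> e * norm (residual B (h a))"
      proof (rule ker')
        fix L assume L: "L \<in> \<Lambda>"
        then show "L (residual B (h a)) = 0"
          using riesz[OF r L] residual_orthogonal[OF B(1) span_base, of "riesz L" "h a"]
          by (simp add: B_def)
      qed (use a A in auto)
      also have "\<dots> \<le> e * (2 / \<sigma>)"
        using norm_residual_le[OF B(1), of "h a"] hnorm[OF a] e0 by (intro mult_left_mono) auto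
      finally show ?thesis by simp
    qed
    then have "(\<Sum>a\<in>A. residual B (h a) \<bullet> a) \<le> real (card A) * (e * (2 / \<sigma>))"
      by (rule sum_bounded_above)
    then have "real (card A) - real (card B) \<le> real (card A) * (e * (2 / \<sigma>))"
      using trace_residual[OF exp h1 B(1) B3] by linarith
    \<comment> \<open>Here \<open>card A - card B\<close> is at least
      \<open>(2 * m + 1) - m\<close>; the estimate \<open>2 * m + 1 \<le> 2 * (m + 1)\<close> then
      yields the constant 4.\<close>
    then have "real m + 1 \<le> (2 * real m + 1) * (e * (2 / \<sigma>))" using A(2) B(2) by (simp add: add_ac)
    then have "(real m + 1) * \<sigma> \<le> (2 * real m + 1) * (2 * e)"
      using \<sigma> by (simp add: field_simps)
    also have "\<dots> \<le> (real m + 1) * (4 * e)" using e0 by (simp add: algebra_simps)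
    finally have "\<sigma> \<le> 4 * e" by (simp add: mult_le_cancel_left)
    then show ?thesis by (simp add: \<sigma>_def)
  qed
  have "\<bar>f \<bullet> s\<bar> \<le> 4 * e"
    if f: "norm f \<le> 1" "\<And>x. x \<in> set xs \<Longrightarrow> f \<bullet> x = 0" and s: "s \<in> S" for f s
  proof -
    have "orthogonal f (s - residual (set xs) s)"
      by (rule orthogonal_to_span[OF residual_diff_in_span]) (use f in \<open>auto simp: orthogonal_def\<close>)
    then have "\<bar>f \<bullet> s\<bar> = \<bar>f \<bullet> residual (set xs) s\<bar>" by (simp add: orthogonal_def inner_diff_right)
    also have "\<dots> \<le> norm f * norm (residual (set xs) s)" by (rule Cauchy_Schwarz_ineq2)
    also have "\<dots> \<le> 1 * (4 * e)" using f(1) main[OF s] by (intro mult_mono) auto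
    finally show ?thesis by simp
  qed
  then show ?thesis using that xs by blast
qed

section \<open>Square-summable complex families as a real inner product space\<close>

text \<open>Scalars are real although the entries are complex: the volume and trace arguments are
  real, and complex values enter through their real parts.\<close>

typedef 'i ell2 = "{f :: 'i \<Rightarrow> complex. (\<lambda>k. (cmod (f k))\<^sup>2) summable_on UNIV}"
  by (rule exI[of _ "\<lambda>_. 0"]) simp

lemma summable_Rep_ell2: "(\<lambda>k. (cmod (Rep_ell2 a k))\<^sup>2) summable_on UNIV"
  using Rep_ell2[of a] by simp

lemma abs_mult_le_sum_squares:
  fixes x y :: real
  shows "\<bar>x * y\<bar> \<le> x\<^sup>2 + y\<^sup>2"
proof -
  have "0 \<le> (\<bar>x\<bar> - \<bar>y\<bar>)\<^sup>2" by simp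
  then have "2 * \<bar>x * y\<bar> \<le> x\<^sup>2 + y\<^sup>2" by (simp add: power2_diff abs_mult)
  then show ?thesis by linarith
qed

lemma summable_inner_ell2: "(\<lambda>k. Rep_ell2 a k \<bullet> Rep_ell2 b k) summable_on UNIV"
proof (rule abs_summable_summable, rule Infinite_Sum.abs_summable_on_comparison_test')
  show "(\<lambda>k. (cmod (Rep_ell2 a k))\<^sup>2 + (cmod (Rep_ell2 b k))\<^sup>2) summable_on UNIV"
    by (intro summable_on_add summable_Rep_ell2)
  show "norm (Rep_ell2 a k \<bullet> Rep_ell2 b k) \<le> (cmod (Rep_ell2 a k))\<^sup>2 + (cmod (Rep_ell2 b k))\<^sup>2" for k
    using Cauchy_Schwarz_ineq2[of "Rep_ell2 a k" "Rep_ell2 b k"]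
      abs_mult_le_sum_squares[of "cmod (Rep_ell2 a k)" "cmod (Rep_ell2 b k)"] by simp
qed

lemma summable_add_ell2: "(\<lambda>k. (cmod (Rep_ell2 a k + Rep_ell2 b k))\<^sup>2) summable_on UNIV"
proof -
  have "(\<lambda>k. (cmod (Rep_ell2 a k))\<^sup>2 + (cmod (Rep_ell2 b k))\<^sup>2 + 2 * (Rep_ell2 a k \<bullet> Rep_ell2 b k))
      summable_on UNIV"
    by (intro summable_on_add summable_on_cmult_right summable_Rep_ell2 summable_inner_ell2)
  then show ?thesis
    by (simp add: power2_norm_eq_inner inner_add_left inner_add_right inner_commute algebra_simps)
qed

lemma summable_scaleR_ell2: "(\<lambda>k. (cmod (r *\<^sub>R Rep_ell2 a k))\<^sup>2) summable_on UNIV"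
  using summable_on_cmult_right[OF summable_Rep_ell2, of "r\<^sup>2" a] by (simp add: power_mult_distrib)

instantiation ell2 :: (type) real_inner
begin

definition "0 = Abs_ell2 (\<lambda>_. 0)"
definition "a + b = Abs_ell2 (\<lambda>k. Rep_ell2 a k + Rep_ell2 b k)"
definition "r *\<^sub>R a = Abs_ell2 (\<lambda>k. r *\<^sub>R Rep_ell2 a k)"
definition "- a = Abs_ell2 (\<lambda>k. - Rep_ell2 a k)"
definition "a - b = Abs_ell2 (\<lambda>k. Rep_ell2 a k + - Rep_ell2 b k)"
definition "a \<bullet> b = (\<Sum>\<^sub>\<infinity>k. Rep_ell2 a k \<bullet> Rep_ell2 b k)"
definition "norm (a :: 'a ell2) = sqrt (a \<bullet> a)"
definition "dist (a :: 'a ell2) b = norm (a - b)"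
definition "sgn (a :: 'a ell2) = inverse (norm a) *\<^sub>R a"
definition
  "(uniformity :: ('a ell2 \<times> 'a ell2) filter) = (INF e\<in>{0 <..}. principal {(x, y). dist x y < e})"
definition
  "open (U :: 'a ell2 set) \<longleftrightarrow> (\<forall>x\<in>U. eventually (\<lambda>(x', y). x' = x \<longrightarrow> y \<in> U) uniformity)"

lemma Rep_ell2_zero: "Rep_ell2 0 k = 0"
  by (simp add: zero_ell2_def Abs_ell2_inverse)

lemma Rep_ell2_add: "Rep_ell2 (a + b) k = Rep_ell2 a k + Rep_ell2 b k"
  by (simp add: plus_ell2_def Abs_ell2_inverse summable_add_ell2)

lemma Rep_ell2_uminus: "Rep_ell2 (- a) k = - Rep_ell2 a k"
  by (simp add: uminus_ell2_def Abs_ell2_inverse summable_Rep_ell2)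

lemma Rep_ell2_scaleR: "Rep_ell2 (r *\<^sub>R a) k = r *\<^sub>R Rep_ell2 a k"
  by (simp add: scaleR_ell2_def Abs_ell2_inverse summable_scaleR_ell2[unfolded scaleR_conv_of_real] scaleR_conv_of_real)

instance
proof
  note rep = Rep_ell2_zero Rep_ell2_add Rep_ell2_uminus Rep_ell2_scaleR
  fix a b c :: "'a ell2" and r s :: real
  show "a + b + c = a + (b + c)" "a + b = b + a" "0 + a = a" "- a + a = 0"
    "r *\<^sub>R (a + b) = r *\<^sub>R a + r *\<^sub>R b" "(r + s) *\<^sub>R a = r *\<^sub>R a + s *\<^sub>R a"
    "r *\<^sub>R s *\<^sub>R a = (r * s) *\<^sub>R a" "1 *\<^sub>R a = a"
    by (auto simp: Rep_ell2_inject[symmetric] fun_eq_iff rep algebra_simps)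
  show "a - b = a + - b" by (simp add: minus_ell2_def plus_ell2_def Rep_ell2_uminus)
  show "dist a b = norm (a - b)" by (rule dist_ell2_def)
  show "sgn a = inverse (norm a) *\<^sub>R a" by (rule sgn_ell2_def)
  show "uniformity = (INF e\<in>{0 <..}. principal {(x, y :: 'a ell2). dist x y < e})"
    by (rule uniformity_ell2_def)
  show "open U \<longleftrightarrow> (\<forall>x\<in>U. eventually (\<lambda>(x', y). x' = x \<longrightarrow> y \<in> U) uniformity)"
    for U :: "'a ell2 set" by (rule open_ell2_def)
  show "a \<bullet> b = b \<bullet> a" by (simp add: inner_ell2_def inner_commute)
  show "(a + b) \<bullet> c = a \<bullet> c + b \<bullet> c"
    by (simp add: inner_ell2_def Rep_ell2_add inner_add_left infsum_add summable_inner_ell2)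
  show "(r *\<^sub>R a) \<bullet> b = r * (a \<bullet> b)"
    by (simp add: inner_ell2_def Rep_ell2_scaleR infsum_cmult_right')
  show "0 \<le> a \<bullet> a" by (simp add: inner_ell2_def infsum_nonneg)
  show "norm a = sqrt (a \<bullet> a)" by (rule norm_ell2_def)
  show "a \<bullet> a = 0 \<longleftrightarrow> a = 0"
  proof
    assume "a \<bullet> a = 0"
    then have "Rep_ell2 a k \<bullet> Rep_ell2 a k = 0" for k
      by (intro nonneg_infsum_le_0D[OF _ summable_inner_ell2]) (auto simp: inner_ell2_def)
    then show "a = 0" by (simp add: Rep_ell2_inject[symmetric] fun_eq_iff Rep_ell2_zero)
  qed (simp add: inner_ell2_def Rep_ell2_zero)
qed

end

lemma power2_norm_ell2: "(norm a)\<^sup>2 = (\<Sum>\<^sub>\<infinity>k. (cmod (Rep_ell2 a k))\<^sup>2)"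
  by (simp add: power2_norm_eq_inner inner_ell2_def)

section \<open>Weighted Fourier spaces and representers of evaluations\<close>

text \<open>Rotating by \<open>\<theta>\<close> turns a modulus into a real part, which a real inner
  product can express.\<close>

lemma unimodular_phase:
  fixes z :: complex
  obtains \<theta> where "cmod \<theta> = 1" "\<theta> * z = of_real (cmod z)"
proof (cases "z = 0")
  case False
  show ?thesis
  proof (rule that[of "cnj z / of_real (cmod z)"])
    show "cnj z / of_real (cmod z) * z = of_real (cmod z)"
      using False complex_norm_square[of z] by (simp add: field_simps power2_eq_square)
  qed (use False in \<open>simp add: norm_divide\<close>)
qed (use that[of 1] in simp)

abbreviation mode :: "nat \<Rightarrow> (nat \<Rightarrow> int) \<Rightarrow> (nat \<Rightarrow> real) \<Rightarrow> complex" where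
  "mode d k x \<equiv> exp (2 * of_real pi * \<i> * of_real (kdot d k x))"

lemma norm_mode: "cmod (mode d k x) = 1"
  by (simp add: norm_exp_eq_Re)

text \<open>Dividing by the weight turns the weighted norm into a plain square sum. Entries off
  \<open>Zd d\<close> are discarded, so on \<open>Hspace\<close> this is a left inverse of
  \<open>embed\<close>, and it can strictly shrink the norm.\<close>

definition coeffs :: "(nat \<Rightarrow> (nat \<Rightarrow> int) \<Rightarrow> real) \<Rightarrow> nat \<Rightarrow> (nat \<Rightarrow> int) ell2 \<Rightarrow> (nat \<Rightarrow> int) \<Rightarrow> complex" where
  "coeffs \<omega> d a k = (if k \<in> Zd d then Rep_ell2 a k / of_real (\<omega> d k) else 0)"

definition embed :: "(nat \<Rightarrow> (nat \<Rightarrow> int) \<Rightarrow> real) \<Rightarrow> nat \<Rightarrow> ((nat \<Rightarrow> int) \<Rightarrow> complex) \<Rightarrow> (nat \<Rightarrow> int) ell2" where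
  "embed \<omega> d c = Abs_ell2 (\<lambda>k. if k \<in> Zd d then c k * of_real (\<omega> d k) else 0)"

text \<open>The Riesz representer of the real functional mapping \<open>f\<close> to the real part of \<open>\<theta> f(x)\<close>.\<close>
definition evaluator :: "(nat \<Rightarrow> (nat \<Rightarrow> int) \<Rightarrow> real) \<Rightarrow> nat \<Rightarrow> complex \<Rightarrow> (nat \<Rightarrow> real) \<Rightarrow> (nat \<Rightarrow> int) ell2" where
  "evaluator \<omega> d \<theta> x = Abs_ell2 (\<lambda>k. if k \<in> Zd d then cnj (\<theta> * mode d k x) / of_real (\<omega> d k) else 0)"

context
  fixes \<omega> :: "nat \<Rightarrow> (nat \<Rightarrow> int) \<Rightarrow> real" and d :: nat
  assumes adm: "admissible_weights \<omega>"
begin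

lemma weight_pos: "k \<in> Zd d \<Longrightarrow> \<omega> d k > 0"
  using adm by (simp add: admissible_weights_def)

lemma weight_summable: "(\<lambda>k. 1 / (\<omega> d k)\<^sup>2) summable_on Zd d"
proof -
  have "(\<lambda>k. (\<omega> d k) powi (-2)) summable_on Zd d"
    using adm by (simp add: admissible_weights_def)
  then show ?thesis by (simp add: power_int_minus field_simps)
qed

lemma Rep_embed:
  assumes "c \<in> Hspace \<omega> d"
  shows "Rep_ell2 (embed \<omega> d c) k = (if k \<in> Zd d then c k * of_real (\<omega> d k) else 0)"
proof -
  have "(\<lambda>k. (cmod (c k))\<^sup>2 * (\<omega> d k)\<^sup>2) summable_on Zd d"
    using assms by (simp add: Hspace_def)
  then have "(\<lambda>k. (cmod (if k \<in> Zd d then c k * of_real (\<omega> d k) else 0))\<^sup>2) summable_on UNIV"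
    by (rule summable_on_cong_neutral[THEN iffD1, rotated -1])
      (auto simp: norm_mult power_mult_distrib)
  then show ?thesis by (simp add: embed_def Abs_ell2_inverse)
qed

lemma norm_embed:
  assumes "c \<in> Hspace \<omega> d"
  shows "norm (embed \<omega> d c) = Hnorm \<omega> d c"
proof -
  have "(norm (embed \<omega> d c))\<^sup>2 = (\<Sum>\<^sub>\<infinity>k\<in>Zd d. (cmod (c k))\<^sup>2 * (\<omega> d k)\<^sup>2)"
    unfolding power2_norm_ell2
    by (rule infsum_cong_neutral) (auto simp: Rep_embed[OF assms] norm_mult power_mult_distrib)
  from real_sqrt_unique[OF this norm_ge_zero] show ?thesis by (simp add: Hnorm_def)
qed

lemma coeffs_embed:
  assumes "c \<in> Hspace \<omega> d"
  shows "coeffs \<omega> d (embed \<omega> d c) = c"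
  using weight_pos assms by (force simp: coeffs_def Rep_embed[OF assms] Hspace_def fun_eq_iff)

lemma coeffs_summable: "(\<lambda>k. (cmod (coeffs \<omega> d a k))\<^sup>2 * (\<omega> d k)\<^sup>2) summable_on Zd d"
  and coeffs_infsum: "(\<Sum>\<^sub>\<infinity>k\<in>Zd d. (cmod (coeffs \<omega> d a k))\<^sup>2 * (\<omega> d k)\<^sup>2) \<le> (norm a)\<^sup>2"
proof -
  have eq: "(cmod (coeffs \<omega> d a k))\<^sup>2 * (\<omega> d k)\<^sup>2 = (cmod (Rep_ell2 a k))\<^sup>2" if "k \<in> Zd d" for k
    using weight_pos[OF that] that by (simp add: coeffs_def norm_divide power_divide)
  have sm: "(\<lambda>k. (cmod (Rep_ell2 a k))\<^sup>2) summable_on Zd d"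
    using summable_Rep_ell2 by (rule summable_on_subset_banach) auto
  show "(\<lambda>k. (cmod (coeffs \<omega> d a k))\<^sup>2 * (\<omega> d k)\<^sup>2) summable_on Zd d"
    using sm by (simp add: eq cong: summable_on_cong)
  show "(\<Sum>\<^sub>\<infinity>k\<in>Zd d. (cmod (coeffs \<omega> d a k))\<^sup>2 * (\<omega> d k)\<^sup>2) \<le> (norm a)\<^sup>2"
    unfolding power2_norm_ell2 by (rule infsum_mono_neutral) (auto simp: eq sm summable_Rep_ell2 cong: summable_on_cong)
qed

lemma coeffs_in_Hspace: "coeffs \<omega> d a \<in> Hspace \<omega> d"
  using coeffs_summable by (simp add: Hspace_def coeffs_def)

lemma Hnorm_coeffs_le: "Hnorm \<omega> d (coeffs \<omega> d a) \<le> norm a"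
  using coeffs_infsum[of a] by (simp add: Hnorm_def real_le_lsqrt)

lemma coeffs_add: "coeffs \<omega> d (a + b) = (\<lambda>k. coeffs \<omega> d a k + coeffs \<omega> d b k)"
  by (auto simp: coeffs_def Rep_ell2_add add_divide_distrib)

lemma coeffs_scaleR: "coeffs \<omega> d (r *\<^sub>R a) = (\<lambda>k. of_real r * coeffs \<omega> d a k)"
  by (auto simp: coeffs_def Rep_ell2_scaleR scaleR_conv_of_real)

text \<open>Write \<open>c k\<close> as \<open>c k * \<omega> d k\<close> times
  \<open>1 / \<omega> d k\<close>; both factors are square summable, so the Fourier series converges
  absolutely.\<close>

lemma fourier_summable:
  assumes "c \<in> Hspace \<omega> d"
  shows "(\<lambda>k. c k * mode d k x) summable_on Zd d"
proof (rule abs_summable_summable, rule Infinite_Sum.abs_summable_on_comparison_test')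
  show "(\<lambda>k. (cmod (c k))\<^sup>2 * (\<omega> d k)\<^sup>2 + 1 / (\<omega> d k)\<^sup>2) summable_on Zd d"
    using assms by (intro summable_on_add weight_summable) (simp add: Hspace_def)
  show "cmod (c k * mode d k x) \<le> (cmod (c k))\<^sup>2 * (\<omega> d k)\<^sup>2 + 1 / (\<omega> d k)\<^sup>2" if "k \<in> Zd d" for k
    using abs_mult_le_sum_squares[of "cmod (c k) * \<omega> d k" "1 / \<omega> d k"] weight_pos[OF that]
    by (simp add: norm_mult norm_mode power_mult_distrib power_divide)
qed

lemma Rep_evaluator:
  assumes "cmod \<theta> = 1"
  shows "Rep_ell2 (evaluator \<omega> d \<theta> x) k
    = (if k \<in> Zd d then cnj (\<theta> * mode d k x) / of_real (\<omega> d k) else 0)"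
proof -
  have "(\<lambda>k. (cmod (if k \<in> Zd d then cnj (\<theta> * mode d k x) / of_real (\<omega> d k) else 0))\<^sup>2) summable_on UNIV"
    using weight_summable
    by (rule summable_on_cong_neutral[THEN iffD1, rotated -1])
      (auto simp: norm_mult norm_divide norm_mode assms power_divide simp del: complex_cnj_mult)
  then show ?thesis by (simp add: evaluator_def Abs_ell2_inverse)
qed

text \<open>Every mode has modulus 1, so neither the phase nor the point matters; this gives the
  uniform bound required for volumes.\<close>

lemma norm_evaluator:
  assumes "cmod \<theta> = 1"
  shows "norm (evaluator \<omega> d \<theta> x) = sqrt (\<Sum>\<^sub>\<infinity>k\<in>Zd d. 1 / (\<omega> d k)\<^sup>2)"
proof -
  have "(norm (evaluator \<omega> d \<theta> x))\<^sup>2 = (\<Sum>\<^sub>\<infinity>k\<in>Zd d. 1 / (\<omega> d k)\<^sup>2)"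
    unfolding power2_norm_ell2
    by (rule infsum_cong_neutral)
      (auto simp: Rep_evaluator[OF assms] norm_mult norm_divide norm_mode assms power_divide simp del: complex_cnj_mult)
  from real_sqrt_unique[OF this norm_ge_zero] show ?thesis by simp
qed

text \<open>The reproducing property in real form. The conjugate in \<open>evaluator\<close> cancels
  the one in the real inner product of complex numbers.\<close>

lemma inner_evaluator:
  assumes "cmod \<theta> = 1"
  shows "a \<bullet> evaluator \<omega> d \<theta> x = Re (\<theta> * fval d (coeffs \<omega> d a) x)"
proof -
  have "\<theta> * fval d (coeffs \<omega> d a) x = (\<Sum>\<^sub>\<infinity>k\<in>Zd d. \<theta> * (coeffs \<omega> d a k * mode d k x))"
    unfolding fval_def by (rule infsum_cmult_right'[symmetric])
  then have "Re (\<theta> * fval d (coeffs \<omega> d a) x) = (\<Sum>\<^sub>\<infinity>k\<in>Zd d. Re (\<theta> * (coeffs \<omega> d a k * mode d k x)))"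
    using infsum_Re[OF summable_on_cmult_right[OF fourier_summable[OF coeffs_in_Hspace]]] by simp
  also have "\<dots> = a \<bullet> evaluator \<omega> d \<theta> x"
    unfolding inner_ell2_def
  proof (rule infsum_cong_neutral)
    fix k assume k: "k \<in> Zd d \<inter> UNIV"
    have "z \<bullet> (cnj w / of_real r) = Re (w * (z / of_real r))" for z w :: complex and r :: real
      by (simp add: inner_complex_def algebra_simps add_divide_distrib diff_divide_distrib)
    from this[of "Rep_ell2 a k" "\<theta> * mode d k x" "\<omega> d k"]
    show "Re (\<theta> * (coeffs \<omega> d a k * mode d k x)) = Rep_ell2 a k \<bullet> Rep_ell2 (evaluator \<omega> d \<theta> x) k"
      using k by (simp add: Rep_evaluator[OF assms] coeffs_def mult_ac del: complex_cnj_mult)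
  qed (auto simp: Rep_evaluator[OF assms])
  finally show ?thesis ..
qed

lemma inner_embed_evaluator:
  assumes "cmod \<theta> = 1" "c \<in> Hspace \<omega> d"
  shows "embed \<omega> d c \<bullet> evaluator \<omega> d \<theta> x = Re (\<theta> * fval d c x)"
  using inner_evaluator[OF assms(1), of "embed \<omega> d c" x] by (simp add: coeffs_embed[OF assms(2)])

text \<open>Boundedness is Cauchy-Schwarz against an evaluator whose phase depends on
  \<open>c\<close> but whose norm does not.\<close>

lemma Lam_std_subset_Lam_all: "Lam_std \<omega> d \<subseteq> Lam_all \<omega> d"
proof
  fix L assume "L \<in> Lam_std \<omega> d"
  then obtain x where L: "\<And>c. L c = fval d c x" by (auto simp: Lam_std_def)
  have "cmod (L c) \<le> sqrt (\<Sum>\<^sub>\<infinity>k\<in>Zd d. 1 / (\<omega> d k)\<^sup>2) * Hnorm \<omega> d c" if c: "c \<in> Hspace \<omega> d" for c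
  proof -
    obtain \<theta> where \<theta>: "cmod \<theta> = 1" "\<theta> * L c = of_real (cmod (L c))" using unimodular_phase by blast
    have "cmod (L c) = embed \<omega> d c \<bullet> evaluator \<omega> d \<theta> x"
      using \<theta>(2) by (simp add: inner_embed_evaluator[OF \<theta>(1) c] L)
    also have "\<dots> \<le> norm (embed \<omega> d c) * norm (evaluator \<omega> d \<theta> x)" by (rule norm_cauchy_schwarz)
    finally show ?thesis by (simp add: norm_embed[OF c] norm_evaluator[OF \<theta>(1)] mult.commute)
  qed
  moreover have "L (\<lambda>k. c k + c' k) = L c + L c'" if "c \<in> Hspace \<omega> d" "c' \<in> Hspace \<omega> d" for c c'
    unfolding L fval_def
    by (simp add: distrib_right infsum_add[OF fourier_summable[OF that(1)] fourier_summable[OF that(2)]])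
  moreover have "L (\<lambda>k. z * c k) = z * L c" for c z
    unfolding L fval_def by (simp add: mult.assoc infsum_cmult_right')
  ultimately show "L \<in> Lam_all \<omega> d" unfolding Lam_all_def by blast
qed

section \<open>Sampling points and minimal errors\<close>

text \<open>Real and imaginary parts turn each functional into two real ones, so
  \<open>vanishing_on_near_maximal_volume\<close> is used with \<open>m\<close> twice the length of
  \<open>Ls\<close>, whence the 4. The 8 is its factor 4 times 2 for the difference of two elements
  of the ball.\<close>

lemma sampling_points:
  assumes Ls: "set Ls \<subseteq> Lam_all \<omega> d"
    and ker: "\<And>c x. c \<in> Hspace \<omega> d \<Longrightarrow> Hnorm \<omega> d c \<le> 1 \<Longrightarrow> (\<And>L. L \<in> set Ls \<Longrightarrow> L c = 0) \<Longrightarrow>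
      x \<in> Td d \<Longrightarrow> cmod (fval d c x) \<le> e"
  obtains ps where "length ps = 4 * length Ls" "set ps \<subseteq> Td d"
    "\<And>c c' x. c \<in> Hspace \<omega> d \<Longrightarrow> Hnorm \<omega> d c \<le> 1 \<Longrightarrow> c' \<in> Hspace \<omega> d \<Longrightarrow> Hnorm \<omega> d c' \<le> 1 \<Longrightarrow>
      (\<And>p. p \<in> set ps \<Longrightarrow> fval d c p = fval d c' p) \<Longrightarrow> x \<in> Td d \<Longrightarrow>
      cmod (fval d c x - fval d c' x) \<le> 8 * e"
proof -
  define S where "S = {evaluator \<omega> d \<theta> x |\<theta> x. cmod \<theta> = 1 \<and> x \<in> Td d}"
  define \<Lambda> where "\<Lambda> = (\<lambda>L a. Re (L (coeffs \<omega> d a))) ` set Ls \<union> (\<lambda>L a. Im (L (coeffs \<omega> d a))) ` set Ls"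
  have "(\<lambda>_. 0) \<in> Td d" by (simp add: Td_def)
  then have "evaluator \<omega> d 1 (\<lambda>_. 0) \<in> S" unfolding S_def by force
  then have "S \<noteq> {}" by blast
  have bd: "norm s \<le> sqrt (\<Sum>\<^sub>\<infinity>k\<in>Zd d. 1 / (\<omega> d k)\<^sup>2)" if "s \<in> S" for s
    using that by (auto simp: S_def norm_evaluator)
  have "card \<Lambda> \<le> length Ls + length Ls"
    unfolding \<Lambda>_def
    by (intro order_trans[OF card_Un_le] add_mono order_trans[OF card_image_le card_length]) auto
  then have \<Lambda>: "finite \<Lambda>" "card \<Lambda> \<le> 2 * length Ls" by (auto simp: \<Lambda>_def)
  have lin: "linear L" if "L \<in> \<Lambda>" for L
  proof -
    have *: "L (coeffs \<omega> d (a + b)) = L (coeffs \<omega> d a) + L (coeffs \<omega> d b)"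
      "L (coeffs \<omega> d (r *\<^sub>R a)) = of_real r * L (coeffs \<omega> d a)" if "L \<in> set Ls" for L a b r
      using that Ls coeffs_in_Hspace by (auto simp: Lam_all_def coeffs_add coeffs_scaleR)
    show ?thesis using that by (auto simp: \<Lambda>_def * intro!: linearI)
  qed
  have small: "\<bar>f \<bullet> s\<bar> \<le> e" if f: "norm f \<le> 1" "\<And>L. L \<in> \<Lambda> \<Longrightarrow> L f = 0" and "s \<in> S" for f s
  proof -
    obtain \<theta> x where s: "s = evaluator \<omega> d \<theta> x" "cmod \<theta> = 1" "x \<in> Td d"
      using \<open>s \<in> S\<close> by (auto simp: S_def)
    have "L (coeffs \<omega> d f) = 0" if "L \<in> set Ls" for L
      using f(2) that by (auto simp: \<Lambda>_def complex_eq_iff)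
    then have "cmod (fval d (coeffs \<omega> d f) x) \<le> e"
      using s(3) f(1) Hnorm_coeffs_le[of f] by (intro ker coeffs_in_Hspace) auto
    moreover have "\<bar>f \<bullet> s\<bar> \<le> cmod (\<theta> * fval d (coeffs \<omega> d f) x)"
      unfolding s(1) inner_evaluator[OF s(2)] by (rule abs_Re_le_cmod)
    ultimately show ?thesis by (simp add: norm_mult s(2))
  qed
  obtain xs where xs: "length xs = 2 * (2 * length Ls)" "set xs \<subseteq> S"
    and van: "\<And>f s. norm f \<le> 1 \<Longrightarrow> (\<And>x. x \<in> set xs \<Longrightarrow> f \<bullet> x = 0) \<Longrightarrow> s \<in> S \<Longrightarrow> \<bar>f \<bullet> s\<bar> \<le> 4 * e"
    using vanishing_on_near_maximal_volume[OF bd \<open>S \<noteq> {}\<close> \<Lambda> lin small] by blast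
  \<comment> \<open>Only the points of the chosen evaluators are sampled: equal complex values there
    make the inner product vanish for every phase.\<close>
  have "\<forall>s\<in>S. \<exists>\<theta> x. s = evaluator \<omega> d \<theta> x \<and> cmod \<theta> = 1 \<and> x \<in> Td d" by (auto simp: S_def)
  then obtain th pt where tp: "\<And>s. s \<in> S \<Longrightarrow> s = evaluator \<omega> d (th s) (pt s) \<and> cmod (th s) = 1 \<and> pt s \<in> Td d"
    by metis
  show ?thesis
  proof (rule that[of "map pt xs"])
    show "set (map pt xs) \<subseteq> Td d" using xs(2) tp by auto
    fix c c' x
    assume c: "c \<in> Hspace \<omega> d" "Hnorm \<omega> d c \<le> 1" and c': "c' \<in> Hspace \<omega> d" "Hnorm \<omega> d c' \<le> 1"
      and eq: "\<And>p. p \<in> set (map pt xs) \<Longrightarrow> fval d c p = fval d c' p" and x: "x \<in> Td d"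
    \<comment> \<open>The factor 1/2 brings the difference of two elements of the unit ball back
      into the ball.\<close>
    define f where "f = (1/2) *\<^sub>R (embed \<omega> d c - embed \<omega> d c')"
    have fe: "f \<bullet> evaluator \<omega> d \<theta> y = Re (\<theta> * (fval d c y - fval d c' y)) / 2" if "cmod \<theta> = 1" for \<theta> y
      unfolding f_def inner_scaleR_left inner_diff_left inner_embed_evaluator[OF that c(1)]
        inner_embed_evaluator[OF that c'(1)]
      by (simp add: algebra_simps)
    have "norm (embed \<omega> d c - embed \<omega> d c') \<le> 2"
      using norm_triangle_ineq4[of "embed \<omega> d c" "embed \<omega> d c'"] c c' by (simp add: norm_embed)
    then have "norm f \<le> 1" by (simp add: f_def)
    moreover have "f \<bullet> s = 0" if "s \<in> set xs" for s
    proof -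
      have s: "s = evaluator \<omega> d (th s) (pt s)" "cmod (th s) = 1" using tp xs(2) that by auto
      have "fval d c (pt s) = fval d c' (pt s)" using eq that by auto
      then have "f \<bullet> evaluator \<omega> d (th s) (pt s) = 0" unfolding fe[OF s(2)] by simp
      then show ?thesis using s(1) by simp
    qed
    moreover obtain \<theta> where \<theta>: "cmod \<theta> = 1"
      "\<theta> * (fval d c x - fval d c' x) = of_real (cmod (fval d c x - fval d c' x))"
      using unimodular_phase by blast
    moreover have "evaluator \<omega> d \<theta> x \<in> S" using \<theta> x by (auto simp: S_def)
    ultimately have "\<bar>f \<bullet> evaluator \<omega> d \<theta> x\<bar> \<le> 4 * e" by (intro van)
    then show "cmod (fval d c x - fval d c' x) \<le> 8 * e" by (simp add: fe[OF \<theta>(1)] \<theta>(2))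
  qed (use xs in simp)
qed

text \<open>Any element of the ball with the observed samples serves as output; the sampled element
  itself shows that one exists.\<close>

lemma err_std_le_radius:
  assumes ps: "length ps = N" "set ps \<subseteq> Td d"
    and rad: "\<And>c c' x. c \<in> Hspace \<omega> d \<Longrightarrow> Hnorm \<omega> d c \<le> 1 \<Longrightarrow> c' \<in> Hspace \<omega> d \<Longrightarrow> Hnorm \<omega> d c' \<le> 1 \<Longrightarrow>
      (\<And>p. p \<in> set ps \<Longrightarrow> fval d c p = fval d c' p) \<Longrightarrow> x \<in> Td d \<Longrightarrow>
      cmod (fval d c x - fval d c' x) \<le> e"
  shows "err_n \<omega> Lam_std d N \<le> ereal e"
proof -
  define U where "U = {c \<in> Hspace \<omega> d. Hnorm \<omega> d c \<le> 1}"
  define Ls where "Ls = map (\<lambda>p c. fval d c p) ps"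
  define rec where "rec y = (SOME c. c \<in> U \<and> map (\<lambda>L. L c) Ls = y)" for y
  have Ls: "length Ls = N" "set Ls \<subseteq> Lam_std \<omega> d" using ps by (auto simp: Ls_def Lam_std_def)
  have "(SUP c\<in>U. sup_dist d (fval d c) (fval d (rec (map (\<lambda>L. L c) Ls)))) \<le> ereal e"
  proof (rule SUP_least)
    fix c assume c: "c \<in> U"
    define c' where "c' = rec (map (\<lambda>L. L c) Ls)"
    have "c' \<in> U \<and> map (\<lambda>L. L c') Ls = map (\<lambda>L. L c) Ls"
      unfolding c'_def rec_def by (rule someI[of _ c]) (use c in simp)
    then have "cmod (fval d c x - fval d c' x) \<le> e" if "x \<in> Td d" for x
      using c that by (intro rad) (auto simp: U_def Ls_def)
    then show "sup_dist d (fval d c) (fval d (rec (map (\<lambda>L. L c) Ls))) \<le> ereal e"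
      by (auto simp: sup_dist_def c'_def intro!: SUP_least)
  qed
  then show ?thesis
    unfolding err_n_def U_def[symmetric]
    by (intro INF_lower2[of "(Ls, \<lambda>y. fval d (rec y))"]) (use Ls in auto)
qed

lemma err_std_le_err_all: "err_n \<omega> Lam_std d (4 * n) \<le> 8 * err_n \<omega> Lam_all d n"
proof -
  define U where "U = {c \<in> Hspace \<omega> d. Hnorm \<omega> d c \<le> 1}"
  have "err_n \<omega> Lam_std d (4 * n) / 8 \<le> (SUP c\<in>U. sup_dist d (fval d c) (\<phi> (map (\<lambda>L. L c) Ls)))"
    (is "_ \<le> ?E")
    if Ls: "length Ls = n" "set Ls \<subseteq> Lam_all \<omega> d"
    for Ls and \<phi> :: "complex list \<Rightarrow> (nat \<Rightarrow> real) \<Rightarrow> complex"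
  proof -
    have E: "ereal (cmod (fval d c x - \<phi> (map (\<lambda>L. L c) Ls) x)) \<le> ?E" if "c \<in> U" "x \<in> Td d" for c x
      by (rule SUP_upper2[OF that(1)]) (auto simp: sup_dist_def intro: SUP_upper that)
    show ?thesis
    \<comment> \<open>An error of plus infinity is trivial, and minus infinity cannot occur because
      the ball and the domain are nonempty.\<close>
    proof (cases ?E)
      case (real e)
      have "cmod (fval d c x) \<le> e"
        if c: "c \<in> Hspace \<omega> d" "Hnorm \<omega> d c \<le> 1" "\<And>L. L \<in> set Ls \<Longrightarrow> L c = 0" and x: "x \<in> Td d" for c x
      proof -
        \<comment> \<open>The data of \<open>c\<close> and of its negative are both zero, so both
          receive the same output \<open>y\<close>; averaging the two errors bounds
          \<open>cmod (fval d c x)\<close> by \<open>e\<close>.\<close>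
        define c' where "c' = (\<lambda>k. (-1) * c k)"
        have c': "c' \<in> U" using c by (simp add: U_def c'_def Hspace_def Hnorm_def)
        have fc': "fval d c' x = - fval d c x" by (simp add: fval_def c'_def infsum_uminus)
        have "L c' = L c" if "L \<in> set Ls" for L
        proof -
          have "L \<in> Lam_all \<omega> d" using Ls that by blast
          then have "L c' = (-1) * L c" using c(1) unfolding c'_def Lam_all_def by blast
          then show ?thesis using c(3)[OF that] by simp
        qed
        then have same: "map (\<lambda>L. L c') Ls = map (\<lambda>L. L c) Ls" by (rule map_cong[OF refl])
        define y where "y = \<phi> (map (\<lambda>L. L c) Ls) x"
        have "cmod (fval d c x - y) \<le> e" "cmod (- fval d c x - y) \<le> e"
          using E[of c x] E[OF c' x] c x real by (simp_all add: U_def same fc' y_def)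
        then have "cmod ((fval d c x - y) - (- fval d c x - y)) \<le> e + e"
          by (rule order_trans[OF norm_triangle_ineq4 add_mono])
        moreover have "(fval d c x - y) - (- fval d c x - y) = 2 * fval d c x" by simp
        ultimately show ?thesis by (simp add: norm_mult)
      qed
      then obtain ps where "length ps = 4 * length Ls" "set ps \<subseteq> Td d"
        "\<And>c c' x. c \<in> Hspace \<omega> d \<Longrightarrow> Hnorm \<omega> d c \<le> 1 \<Longrightarrow> c' \<in> Hspace \<omega> d \<Longrightarrow> Hnorm \<omega> d c' \<le> 1 \<Longrightarrow>
          (\<And>p. p \<in> set ps \<Longrightarrow> fval d c p = fval d c' p) \<Longrightarrow> x \<in> Td d \<Longrightarrow>
          cmod (fval d c x - fval d c' x) \<le> 8 * e"
        using sampling_points[OF Ls(2)] by blast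
      then have "err_n \<omega> Lam_std d (4 * n) \<le> ereal (8 * e)"
        using Ls(1) by (intro err_std_le_radius) auto
      then show ?thesis unfolding real by (simp add: ereal_divide_le_pos mult.commute)
    next
      case MInf
      have "(\<lambda>_. 0) \<in> U" "(\<lambda>_. 0) \<in> Td d" by (auto simp: U_def Hspace_def Hnorm_def Td_def)
      from E[OF this] show ?thesis unfolding MInf by simp
    qed simp
  qed
  then have "err_n \<omega> Lam_std d (4 * n) / 8 \<le> err_n \<omega> Lam_all d n"
    unfolding err_n_def[of \<omega> Lam_all] U_def[symmetric] by (intro INF_greatest) auto
  then show ?thesis by (simp add: ereal_divide_le_pos)
qed

lemma err_all_le_err_std: "err_n \<omega> Lam_all d n \<le> err_n \<omega> Lam_std d n"
  unfolding err_n_def by (rule INF_superset_mono) (use Lam_std_subset_Lam_all in auto)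

end

section \<open>Transfer of tractability\<close>

text \<open>With \<open>l = ln (1 / \<epsilon>)\<close> and \<open>q = ln K\<close>, use
  \<open>l + q + 1 \<le> (1 + q) * (l + 1)\<close> and, after the logarithm,
  \<open>1 + a + b \<le> (1 + a) * (1 + b)\<close> for nonnegative \<open>a\<close> and
  \<open>b\<close>. A constant loss of accuracy thus only rescales the exponent.\<close>

lemma ln_ln_scale_le:
  fixes \<epsilon> K :: real
  assumes "0 < \<epsilon>" "\<epsilon> < 1" "1 \<le> K"
  shows "1 + ln (ln (1 / (\<epsilon> / K)) + 1) \<le> (1 + ln (1 + ln K)) * (1 + ln (ln (1 / \<epsilon>) + 1))"
proof -
  define l where "l = ln (1 / \<epsilon>)"
  define q where "q = ln K"
  have l: "0 \<le> l" "0 \<le> q" using assms by (auto simp: l_def q_def intro!: ln_ge_zero)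
  have "0 \<le> l * q" using l by simp
  have "ln (1 / (\<epsilon> / K)) + 1 = l + q + 1" using assms by (simp add: l_def q_def ln_div ln_mult)
  also have "ln (l + q + 1) \<le> ln ((1 + q) * (l + 1))"
    using l \<open>0 \<le> l * q\<close> by (intro ln_mono) (simp_all add: algebra_simps add_pos_nonneg)
  also have "\<dots> = ln (1 + q) + ln (l + 1)" using l by (simp add: ln_mult)
  finally have "1 + ln (ln (1 / (\<epsilon> / K)) + 1) \<le> 1 + ln (1 + q) + ln (l + 1)"
    by (simp add: add.assoc)
  also have "\<dots> \<le> (1 + ln (1 + q)) * (1 + ln (l + 1))"
    using l by (simp add: algebra_simps)
  finally show ?thesis by (simp add: l_def q_def)
qed

text \<open>Accuracy \<open>\<epsilon> / K\<close> for \<open>Lam\<close> gives accuracy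
  \<open>\<epsilon>\<close> for \<open>Lam'\<close> with \<open>m\<close> times as many functionals;
  \<open>m\<close> goes into the constant and \<open>K\<close> into the exponent. The criterion
  factor is common to both sides, so both criteria are treated at once.\<close>

lemma EXP_QPT_transfer:
  assumes err: "\<And>d n. err_n \<omega> Lam' d (m * n) \<le> ereal K * err_n \<omega> Lam d n"
    and "1 \<le> K" "1 \<le> m" and qpt: "EXP_QPT \<omega> Lam cr"
  shows "EXP_QPT \<omega> Lam' cr"
proof -
  obtain C t where "C > 0" "t \<ge> 0" and
    *: "\<And>d \<epsilon>::real. 1 \<le> d \<Longrightarrow> 0 < \<epsilon> \<Longrightarrow> \<epsilon> < 1 \<Longrightarrow>
        (\<exists>n. err_n \<omega> Lam d n \<le> ereal \<epsilon> * CRI cr \<omega> d) \<and>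
        real (LEAST n. err_n \<omega> Lam d n \<le> ereal \<epsilon> * CRI cr \<omega> d)
          \<le> C * exp (t * (1 + ln (real d)) * (1 + ln (ln (1 / \<epsilon>) + 1)))"
    using qpt unfolding EXP_QPT_def by blast
  define t' where "t' = t * (1 + ln (1 + ln K))"
  have t': "t' \<ge> 0" using \<open>t \<ge> 0\<close> \<open>1 \<le> K\<close> by (simp add: t'_def)
  have "(\<exists>n. err_n \<omega> Lam' d n \<le> ereal \<epsilon> * CRI cr \<omega> d) \<and>
        real (LEAST n. err_n \<omega> Lam' d n \<le> ereal \<epsilon> * CRI cr \<omega> d)
          \<le> real m * C * exp (t' * (1 + ln (real d)) * (1 + ln (ln (1 / \<epsilon>) + 1)))"
    if d: "1 \<le> d" and \<epsilon>: "0 < \<epsilon>" "\<epsilon> < 1" for d \<epsilon>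
  proof -
    have \<epsilon>K: "0 < \<epsilon> / K" "\<epsilon> / K < 1" using \<epsilon> \<open>1 \<le> K\<close> by (auto simp: field_simps)
    define n where "n = (LEAST n. err_n \<omega> Lam d n \<le> ereal (\<epsilon> / K) * CRI cr \<omega> d)"
    have n: "err_n \<omega> Lam d n \<le> ereal (\<epsilon> / K) * CRI cr \<omega> d"
      unfolding n_def by (rule LeastI_ex[OF conjunct1[OF *[OF d \<epsilon>K]]])
    have nle: "real n \<le> C * exp (t * (1 + ln (real d)) * (1 + ln (ln (1 / (\<epsilon> / K)) + 1)))"
      unfolding n_def by (rule conjunct2[OF *[OF d \<epsilon>K]])
    have "err_n \<omega> Lam' d (m * n) \<le> ereal K * (ereal (\<epsilon> / K) * CRI cr \<omega> d)"
      using err[of d n] ereal_mult_left_mono[OF n, of "ereal K"] \<open>1 \<le> K\<close> by (simp add: order_trans)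
    also have "\<dots> = ereal \<epsilon> * CRI cr \<omega> d"
      using \<open>1 \<le> K\<close> by (simp add: mult.assoc[symmetric])
    finally have e: "err_n \<omega> Lam' d (m * n) \<le> ereal \<epsilon> * CRI cr \<omega> d" .
    then have "real (LEAST n. err_n \<omega> Lam' d n \<le> ereal \<epsilon> * CRI cr \<omega> d) \<le> real m * real n"
      by (metis Least_le of_nat_le_iff of_nat_mult)
    also have "\<dots> \<le> real m * (C * exp (t * (1 + ln (real d)) * (1 + ln (ln (1 / (\<epsilon> / K)) + 1))))"
      using nle by (intro mult_left_mono) auto
    also have "\<dots> \<le> real m * (C * exp (t' * (1 + ln (real d)) * (1 + ln (ln (1 / \<epsilon>) + 1))))"
    proof -
      have "t * (1 + ln (real d)) * (1 + ln (ln (1 / (\<epsilon> / K)) + 1))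
          \<le> t * (1 + ln (real d)) * ((1 + ln (1 + ln K)) * (1 + ln (ln (1 / \<epsilon>) + 1)))"
        using ln_ln_scale_le[OF \<epsilon> \<open>1 \<le> K\<close>] \<open>t \<ge> 0\<close> d by (intro mult_left_mono) auto
      then show ?thesis using \<open>C > 0\<close> by (intro mult_left_mono) (auto simp: t'_def mult_ac)
    qed
    finally show ?thesis using e by (auto simp: mult.assoc)
  qed
  moreover have "real m * C > 0" using \<open>C > 0\<close> \<open>1 \<le> m\<close> by simp
  ultimately show ?thesis unfolding EXP_QPT_def using t' by blast
qed

theorem theorem4p2:
  fixes \<omega> :: "nat \<Rightarrow> (nat \<Rightarrow> int) \<Rightarrow> real" and cr :: criterion
  assumes "admissible_weights \<omega>"
  shows "EXP_QPT \<omega> Lam_all cr \<longleftrightarrow> EXP_QPT \<omega> Lam_std cr"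
proof
  assume "EXP_QPT \<omega> Lam_all cr"
  then show "EXP_QPT \<omega> Lam_std cr"
    by (rule EXP_QPT_transfer[where m = 4 and K = 8, rotated -1])
      (use err_std_le_err_all[OF assms] in auto)
next
  assume "EXP_QPT \<omega> Lam_std cr"
  \<comment> \<open>Point evaluations are themselves continuous functionals, so nothing is lost in
    this direction and both constants are 1.\<close>
  then show "EXP_QPT \<omega> Lam_all cr"
    by (rule EXP_QPT_transfer[where m = 1 and K = 1, rotated -1])
      (use err_all_le_err_std[OF assms] in \<open>auto simp: one_ereal_def[symmetric]\<close>)
qed

end
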